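(* Let $s$ and $m$ be real constants such that $sm>0$, and such that $m$ is a positive integer if $s>0$. For each integer $n\ge 1$ let $F_n$ denote the (finite) set of ordered trees with $n$ vertices, and give each ordered tree $T$ the weight $$w(T)=\prod_{v\in T}\binom{m}{d_v}s^{d_v},$$ where $d_v$ is the number of children of the vertex $v$ in $T$. Let $h_v$ be the hook length of $v$ in $T$, i.e. the number of descendants of $v$ in $T$, including $v$ itself. Then for every $n=1,2,\ldots$, $$\sum_{T\in F_n}w(T)\prod_{v\in T}\frac{1}{h_v m^{h_v-1}}=\frac{s^{n-1}}{n!}$$ and $$\sum_{T\in F_n}w(T)\prod_{v\in T}\frac{(z+h_v)^{h_v-1}}{h_v(mz+h_v-1)^{h_v-2}}=\frac{s^{n-1}m^n z}{n!}(z+n)^{n-1},$$ where the second equality is an identity of rational functions in the variable $z$.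
   Context: An ordered tree is a finite (unlabelled) rooted tree in which a linear ordering is specified for the children of each vertex; two such trees are identified if they are isomorphic as rooted trees by an isomorphism preserving the orderings of children. Products $\prod_{v\in T}$ run over all vertices $v$ of $T$. The descendants of $v$ are the vertices $u$ such that $v$ lies on the path from the root to $u$. For a real number $m$ and integer $d\ge 0$, $\binom{m}{d}=\frac{m(m-1)\cdots(m-d+1)}{d!}$ is the generalized binomial coefficient (with $\binom{m}{0}=1$). The family of ordered trees with the weights $w(T)$ is called the binomial family, or $(s,m)$-family, and $F_n$ is its subset of trees with $n$ vertices. When $h_v=1$, the factor $(mz+h_v-1)^{h_v-2}$ in the denominator is $(mz)^{-1}$, so the corresponding factor of the product equals $mz$. *)

theory Defs
  imports "HOL-Computational_Algebra.Computational_Algebra" "HOL-Library.Sublist"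
begin

datatype ordered_tree = Node (children: "ordered_tree list")

text \<open>
  A vertex is identified with its address: the sequence of child indices leading from the root
  to it. Hence \<^term>\<open>v\<close> lies on the path from the root to \<^term>\<open>u\<close> iff \<^term>\<open>v\<close> is a
  prefix of \<^term>\<open>u\<close>.
\<close>

lemma size_nth_less [termination_simp]:
  "i < length ts \<Longrightarrow> size (ts ! i) < Suc (size_list size ts)"
  using size_list_estimation'[OF nth_mem, of i ts "size (ts ! i)" size] by simp

fun vertices :: "ordered_tree \<Rightarrow> nat list set" where
  "vertices (Node ts) = insert [] (\<Union>i<length ts. (#) i ` vertices (ts ! i))"

definition num_children :: "ordered_tree \<Rightarrow> nat list \<Rightarrow> nat" where
  "num_children T v = card {u \<in> vertices T. \<exists>i. u = v @ [i]}"

definition descendants :: "ordered_tree \<Rightarrow> nat list \<Rightarrow> nat list set" where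
  "descendants T v = {u \<in> vertices T. prefix v u}"

definition hook_length :: "ordered_tree \<Rightarrow> nat list \<Rightarrow> nat" where
  "hook_length T v = card (descendants T v)"

definition trees_of_size :: "nat \<Rightarrow> ordered_tree set" where
  "trees_of_size n = {T. card (vertices T) = n}"

definition binomial_weight :: "real \<Rightarrow> real \<Rightarrow> ordered_tree \<Rightarrow> real" where
  "binomial_weight s m T =
     (\<Prod>v\<in>vertices T. (m gchoose num_children T v) * s ^ num_children T v)"

text \<open>The field of rational functions over the reals: constants and the variable.\<close>

definition rf_const :: "real \<Rightarrow> real poly fract" where
  "rf_const c = to_fract [:c:]"

definition rf_var :: "real poly fract" where
  "rf_var = to_fract [:0, 1:]"

lemma finite_vertices: "finite (vertices T)"
  by (induction T) auto

lemma card_vertices_Node: "card (vertices (Node ts)) = Suc (\<Sum>t\<leftarrow>ts. card (vertices t))"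
proof -
  have "card (\<Union>i<length ts. (#) i ` vertices (ts ! i))
      = (\<Sum>i<length ts. card ((#) i ` vertices (ts ! i)))"
    by (rule card_UN_disjoint) (auto simp: finite_vertices)
  also have "\<dots> = (\<Sum>i<length ts. card (vertices (ts ! i)))"
    by (simp add: card_image)
  also have "\<dots> = (\<Sum>t\<leftarrow>ts. card (vertices t))"
    by (simp add: sum_list_sum_nth atLeast0LessThan)
  finally show ?thesis
    by (subst vertices.simps, subst card_insert_disjoint) (auto simp: finite_vertices)
qed

lemma card_vertices_pos: "card (vertices T) > 0"
  by (cases T) (simp add: card_vertices_Node del: vertices.simps)

lemma finite_trees_of_size: "finite (trees_of_size n)"
proof (induction n rule: less_induct)
  case (less n)
  let ?S = "\<Union>k<n. trees_of_size k"
  have fin: "finite ?S" using less by auto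
  have "trees_of_size n \<subseteq> Node ` {ts. set ts \<subseteq> ?S \<and> length ts \<le> n}"
  proof
    fix T assume "T \<in> trees_of_size n"
    moreover obtain ts where T: "T = Node ts" by (cases T)
    ultimately have n: "n = Suc (\<Sum>t\<leftarrow>ts. card (vertices t))"
      by (simp add: trees_of_size_def card_vertices_Node del: vertices.simps)
    have "card (vertices t) \<le> (\<Sum>t\<leftarrow>ts. card (vertices t))" if "t \<in> set ts" for t
      using that by (intro member_le_sum_list) auto
    hence 1: "set ts \<subseteq> ?S" using n by (fastforce simp: trees_of_size_def)
    have "length ts \<le> (\<Sum>t\<leftarrow>ts. card (vertices t))"
    proof (induction ts)
      case (Cons t ts)
      thus ?case using card_vertices_pos[of t] by simp
    qed simp
    thus "T \<in> Node ` {ts. set ts \<subseteq> ?S \<and> length ts \<le> n}"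
      using 1 n T by auto
  qed
  thus ?case
    using finite_lists_length_le[OF fin, of n] finite_subset by blast
qed

end

theory Submission
  imports Defs
begin

text \<open>
  Splitting a tree at its root shows that for weights \<open>\<Prod>\<^sub>v c(d\<^sub>v) g(h\<^sub>v)\<close> the generating function
  \<open>A\<close> of the sums over \<open>F\<^sub>n\<close> is determined by
  \<open>[x^(k+1)] A = g(k+1) \<cdot> [x^k] (\<Sum>\<^sub>d c(d) A^d)\<close>. For the binomial family the inner series is
  \<open>(1 + s A)^m\<close>. In the first identity \<open>1 + s A = exp (s x)\<close>. In the second,
  \<open>1 + s A = E\<^sub>z(s m x)\<close> for the Abel series \<open>E\<^sub>a(x) = \<Sum>\<^sub>n a (a + n)^(n-1) x^n / n!\<close>, and Abel's
  identity gives \<open>E\<^sub>a^m = E\<^sub>m\<^sub>a\<close>. The coefficients being polynomials in \<open>z\<close>, this may be checked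
  at real values of \<open>z\<close>.
\<close>

section \<open>Abel's binomial identity for formal power series\<close>

text \<open>Up to the factor j!, the sum is the coefficient of x^j in exp(a x) (exp x - 1)^n, a
  series of order at least n > j.\<close>

lemma alternating_sum_power_eq_0:
  fixes a :: real
  assumes "j < n"
  shows "(\<Sum>k\<le>n. (-1) ^ (n - k) * of_nat (n choose k) * (a + of_nat k) ^ j) = 0"
proof -
  have "fps_exp a * (fps_exp 1 - 1) ^ n
      = (\<Sum>k\<le>n. fps_const ((-1) ^ (n - k) * of_nat (n choose k)) * fps_exp (a + of_nat k))"
  proof -
    have "(fps_exp 1 - 1) ^ n
        = (\<Sum>k\<le>n. of_nat (n choose k) * fps_exp (1::real) ^ k * (-1) ^ (n - k))"
      using binomial_ring[of "fps_exp (1::real)" "-1" n] by simp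
    moreover have "(-1) ^ i = fps_const ((-1::real) ^ i)" for i
      by (simp flip: fps_const_power fps_const_neg)
    ultimately show ?thesis
      by (simp add: sum_distrib_left fps_exp_add_mult fps_exp_power_mult fps_of_nat [symmetric]
            mult_ac flip: fps_const_mult)
  qed
  hence "(fps_exp a * (fps_exp 1 - 1) ^ n) $ j
      = (\<Sum>k\<le>n. (-1) ^ (n - k) * of_nat (n choose k) * ((a + of_nat k) ^ j / fact j))"
    by (simp add: fps_sum_nth)
  moreover have "(fps_exp (1::real) - 1) ^ n $ i = 0" if "i \<le> j" for i
    using startsby_zero_power_prefix[of "fps_exp (1::real) - 1" n] that assms by simp
  hence "(fps_exp a * (fps_exp 1 - 1) ^ n) $ j = 0"
    by (simp add: fps_mult_nth)
  ultimately show ?thesis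
    by (simp flip: sum_divide_distrib)
qed

text \<open>The case n = 0 stands for a * a^(-1) = 1; with truncated subtraction the general formula
  would give a there.\<close>

definition abel_fps :: "real \<Rightarrow> real fps" where
  "abel_fps a = Abs_fps (\<lambda>n. if n = 0 then 1 else a * (a + of_nat n) ^ (n - 1) / fact n)"

text \<open>With T the tree function, T = x exp T, this is exp(b T) / (1 - T), while
  \<open>abel_fps b\<close> is exp(b T).\<close>

definition abel_fps' :: "real \<Rightarrow> real fps" where
  "abel_fps' b = Abs_fps (\<lambda>n. (b + of_nat n) ^ n / fact n)"

text \<open>Induction on the coefficient index with b varying: differentiating in b lowers the index
  by one and shifts b to b + 1.\<close>

lemma abel_identity: "abel_fps a * abel_fps' b = abel_fps' (a + b)"
proof -
  have "(\<Sum>k\<le>n. abel_fps a $ k * abel_fps' b $ (n - k)) = abel_fps' (a + b) $ n" for n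
  proof (induction n arbitrary: b)
    case 0
    show ?case by (simp add: abel_fps_def abel_fps'_def)
  next
    case (Suc n)
    define D where "D = (\<lambda>b. (\<Sum>k\<le>Suc n. abel_fps a $ k * abel_fps' b $ (Suc n - k))
      - abel_fps' (a + b) $ Suc n)"
    \<comment> \<open>The offset c serves both sides of the identity: c = 0 under the sum and c = a
      on the right.\<close>
    have deriv: "((\<lambda>b. abel_fps' (c + b) $ Suc j) has_real_derivative abel_fps' (c + b + 1) $ j) (at b)"
      for c b j
      unfolding abel_fps'_def fps_nth_Abs_fps
      by (auto intro!: derivative_eq_intros simp del: of_nat_Suc power_Suc)
        (simp add: algebra_simps divide_simps)
    \<comment> \<open>\<open>D\<close> is constant by the induction hypothesis at \<open>b + 1\<close>. At \<open>b = - a - (n + 1)\<close> the right-hand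
      side of the identity vanishes and the left-hand side is an \<open>(n + 1)\<close>-st difference of a
      polynomial of degree \<open>n\<close>.\<close>
    have "D b = D (- a - of_nat (Suc n))"
    proof (rule DERIV_isconst_all[of D], rule allI)
      fix b
      \<comment> \<open>The term k = n + 1 is split off: its factor \<open>abel_fps' b $ 0\<close>
        is 1 for every b, so its derivative is 0.\<close>
      have "((\<lambda>b. (\<Sum>k\<le>n. abel_fps a $ k * abel_fps' (0 + b) $ Suc (n - k)) + abel_fps a $ Suc n
          - abel_fps' (a + b) $ Suc n) has_real_derivative
          (\<Sum>k\<le>n. abel_fps a $ k * abel_fps' (0 + b + 1) $ (n - k)) + 0 - abel_fps' (a + b + 1) $ n) (at b)"
        by (intro derivative_intros DERIV_cmult DERIV_sum deriv)
      moreover have "abel_fps' b $ 0 = 1" for b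
        by (simp add: abel_fps'_def)
      hence "D = (\<lambda>b. (\<Sum>k\<le>n. abel_fps a $ k * abel_fps' (0 + b) $ Suc (n - k)) + abel_fps a $ Suc n
          - abel_fps' (a + b) $ Suc n)"
        by (simp add: D_def Suc_diff_le)
      ultimately show "(D has_real_derivative 0) (at b)"
        using Suc.IH[of "b + 1"] by (simp add: add.assoc)
    qed
    also have "\<dots> = 0"
    proof -
      have "abel_fps a $ k * abel_fps' (- a - of_nat (Suc n)) $ (Suc n - k)
          = a / fact (Suc n) *
            ((-1) ^ (Suc n - k) * of_nat (Suc n choose k) * (a + of_nat k) ^ n)"
        if k: "k \<le> Suc n" for k
      proof -
        have arg: "- a - real (Suc n) + real (Suc n - k) = - (a + real k)"
          using k by (simp add: of_nat_diff)
        \<comment> \<open>For k = 0 the factor a comes out of a^(n+1), so the special constant term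
          fits the same formula.\<close>
        have pow: "(if k = 0 then 1 else a * (a + real k) ^ (k - 1)) * (a + real k) ^ (Suc n - k)
            = a * (a + real k) ^ n"
        proof (cases "k = 0")
          case False
          hence "k - 1 + (Suc n - k) = n" using k by simp
          thus ?thesis using False by (simp add: mult.assoc flip: power_add)
        qed simp
        have A: "abel_fps a $ k = (if k = 0 then 1 else a * (a + real k) ^ (k - 1)) / fact k"
          by (simp add: abel_fps_def)
        have "abel_fps a $ k * abel_fps' (- a - of_nat (Suc n)) $ (Suc n - k)
            = (-1) ^ (Suc n - k) * ((if k = 0 then 1 else a * (a + real k) ^ (k - 1)) *
              (a + real k) ^ (Suc n - k)) / (fact k * fact (Suc n - k))"
          unfolding A abel_fps'_def fps_nth_Abs_fps arg
          by (subst power_minus) (simp only: times_divide_times_eq mult_ac)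
        also have "\<dots> = a / fact (Suc n) *
            ((-1) ^ (Suc n - k) * of_nat (Suc n choose k) * (a + of_nat k) ^ n)"
          unfolding pow binomial_fact[OF k]
          by (simp del: fact_Suc)
        finally show ?thesis .
      qed
      hence "D (- a - of_nat (Suc n)) = a / fact (Suc n) *
          (\<Sum>k\<le>Suc n. (-1) ^ (Suc n - k) * of_nat (Suc n choose k) * (a + of_nat k) ^ n)
          - abel_fps' (a + (- a - of_nat (Suc n))) $ Suc n"
        unfolding D_def sum_distrib_left by (intro arg_cong2[where f = "(-)"] sum.cong) auto
      also have "abel_fps' (a + (- a - of_nat (Suc n))) $ Suc n = 0"
        by (simp add: abel_fps'_def)
      finally show ?thesis
        using alternating_sum_power_eq_0[of n "Suc n" a] by simp
    qed
    finally show ?case by (simp add: D_def)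
  qed
  thus ?thesis by (simp add: fps_eq_iff fps_mult_nth atLeast0AtMost)
qed

text \<open>Turns a differential equation between Abel series into an equation between products
  covered by \<open>abel_identity\<close>.\<close>

lemma abel_fps_deriv: "fps_deriv (abel_fps a) = fps_const a * abel_fps' (a + 1)"
proof (rule fps_ext)
  fix n
  have "fps_deriv (abel_fps a) $ n = real (Suc n) * (a * (a + real (Suc n)) ^ n) / (real (Suc n) * fact n)"
    by (simp add: abel_fps_def)
  also have "\<dots> = a * (a + real (Suc n)) ^ n / fact n"
    by (rule mult_divide_mult_cancel_left) simp
  finally show "fps_deriv (abel_fps a) $ n = (fps_const a * abel_fps' (a + 1)) $ n"
    by (simp add: abel_fps'_def algebra_simps)
qed

section \<open>Real powers of power series with constant term 1\<close>

text \<open>Substituting U into (1 + x) B' = m B for the binomial series B shows that F = (1 + U)^m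
  solves the same linear equation as G. Cancelling 1 + U gives F' G = F G', so F / G is constant,
  and its constant term is 1.\<close>

lemma fps_binomial_compose_eqI:
  fixes U G :: "real fps"
  assumes U0: "U $ 0 = 0" and G0: "G $ 0 = 1"
    and ode: "(1 + U) * fps_deriv G = fps_const m * G * fps_deriv U"
  shows "fps_binomial m oo U = G"
proof -
  define F where "F = fps_binomial m oo U"
  have "(1 + fps_X) * fps_deriv (fps_binomial m) = fps_const m * fps_binomial m"
    by (subst fps_binomial_deriv) (simp add: fps_divide_unit mult_ac inverse_mult_eq_1')
  hence "((1 + fps_X) * fps_deriv (fps_binomial m)) oo U = (fps_const m * fps_binomial m) oo U"
    by simp
  hence "(1 + U) * (fps_deriv (fps_binomial m) oo U) = fps_const m * F"
    using U0 by (simp add: fps_compose_mult_distrib fps_compose_add_distrib F_def)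
  hence F: "(1 + U) * fps_deriv F = fps_const m * F * fps_deriv U"
    unfolding F_def fps_compose_deriv[OF U0] by (simp add: mult.assoc [symmetric])
  have "(1 + U) * (fps_deriv F * G - F * fps_deriv G)
      = ((1 + U) * fps_deriv F) * G - F * ((1 + U) * fps_deriv G)"
    by (simp add: algebra_simps)
  also have "\<dots> = 0"
    unfolding F ode by (simp add: algebra_simps)
  finally have "(1 + U) * (fps_deriv F * G - F * fps_deriv G) = 0" .
  moreover have "1 + U \<noteq> 0"
    using U0 by (metis fps_add_nth fps_one_nth fps_zero_nth add.right_neutral zero_neq_one)
  ultimately have eq: "fps_deriv F * G = F * fps_deriv G"
    by simp
  have unit: "G * inverse G = 1"
    using G0 by (simp add: inverse_mult_eq_1')
  have "fps_deriv (F * inverse G) = fps_deriv F * (G * inverse G) * inverse G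
      - F * fps_deriv G * (inverse G)\<^sup>2"
    using G0 by (simp add: fps_inverse_deriv unit)
  also have "\<dots> = (fps_deriv F * G - F * fps_deriv G) * (inverse G)\<^sup>2"
    by (simp add: algebra_simps power2_eq_square)
  finally have "fps_deriv (F * inverse G) = 0"
    unfolding eq by (simp only: diff_self mult_zero_left)
  hence "F * inverse G = fps_const ((F * inverse G) $ 0)"
    unfolding fps_deriv_eq_0_iff .
  also have "\<dots> = 1"
    using G0 by (simp add: F_def)
  finally have "F * (G * inverse G) = G"
    by (metis mult.assoc mult.commute mult_1)
  thus ?thesis by (simp add: unit F_def)
qed

lemma fps_binomial_compose_exp:
  fixes m s :: real
  shows
  "fps_binomial m oo (fps_exp s - 1) = fps_exp (m * s)"
  by (rule fps_binomial_compose_eqI) (simp_all add: mult_ac flip: fps_const_mult)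

text \<open>Both sides of the differential equation equal m a times
  \<open>abel_fps' (a + m * a + 1)\<close>.\<close>

lemma fps_binomial_compose_abel:
  "fps_binomial m oo (abel_fps a - 1) = abel_fps (m * a)"
proof (rule fps_binomial_compose_eqI)
  have "abel_fps a * abel_fps' (m * a + 1) = abel_fps (m * a) * abel_fps' (a + 1)"
    by (simp add: abel_identity add_ac)
  thus "(1 + (abel_fps a - 1)) * fps_deriv (abel_fps (m * a))
      = fps_const m * abel_fps (m * a) * fps_deriv (abel_fps a - 1)"
    by (simp add: abel_fps_deriv mult_ac flip: fps_const_mult)
qed (simp_all add: abel_fps_def)

section \<open>Hook weights when a tree is split at its root\<close>

lemma Nil_mem_vertices: "[] \<in> vertices T"
  by (cases T) simp

lemma num_children_Node_Nil: "num_children (Node ts) [] = length ts"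
proof -
  have "{u \<in> vertices (Node ts). \<exists>i. u = [] @ [i]} = (\<lambda>i. [i]) ` {..<length ts}"
    using Nil_mem_vertices by auto
  thus ?thesis by (simp add: num_children_def card_image inj_on_def)
qed

lemma num_children_Node_Cons:
  assumes "i < length ts"
  shows "num_children (Node ts) (i # v) = num_children (ts ! i) v"
proof -
  have "{u \<in> vertices (Node ts). \<exists>j. u = (i # v) @ [j]}
      = (#) i ` {u \<in> vertices (ts ! i). \<exists>j. u = v @ [j]}"
    using assms by auto
  thus ?thesis by (simp add: num_children_def card_image)
qed

lemma hook_length_Nil: "hook_length T [] = card (vertices T)"
  by (simp add: hook_length_def descendants_def)

lemma hook_length_Node_Cons:
  assumes "i < length ts"
  shows "hook_length (Node ts) (i # v) = hook_length (ts ! i) v"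
proof -
  have "descendants (Node ts) (i # v) = (#) i ` descendants (ts ! i) v"
    using assms by (auto simp: descendants_def)
  thus ?thesis by (simp add: hook_length_def card_image)
qed

lemma prod_vertices_Node:
  fixes f :: "nat list \<Rightarrow> 'a::comm_monoid_mult"
  shows "(\<Prod>v\<in>vertices (Node ts). f v) = f [] * (\<Prod>i<length ts. \<Prod>v\<in>vertices (ts ! i). f (i # v))"
proof -
  have "(\<Prod>v\<in>(\<Union>i<length ts. (#) i ` vertices (ts ! i)). f v)
      = (\<Prod>i<length ts. \<Prod>v\<in>(#) i ` vertices (ts ! i). f v)"
    by (rule prod.UNION_disjoint) (auto simp: finite_vertices)
  also have "\<dots> = (\<Prod>i<length ts. \<Prod>v\<in>vertices (ts ! i). f (i # v))"
    by (simp add: prod.reindex)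
  finally show ?thesis
    unfolding vertices.simps by (subst prod.insert) (auto simp: finite_vertices)
qed

text \<open>Keeping c and g arbitrary lets one recursion serve both identities, over the reals and
  over the rational functions.\<close>

definition hook_weight :: "(nat \<Rightarrow> 'a) \<Rightarrow> (nat \<Rightarrow> 'a) \<Rightarrow> ordered_tree \<Rightarrow> 'a::comm_semiring_1" where
  "hook_weight c g T = (\<Prod>v\<in>vertices T. c (num_children T v) * g (hook_length T v))"

text \<open>All descendants of a non-root vertex lie in its own branch, so its child count and hook
  length are those in the branch; only the root adds a factor.\<close>

lemma hook_weight_Node:
  "hook_weight c g (Node ts)
    = c (length ts) * g (card (vertices (Node ts))) * prod_list (map (hook_weight c g) ts)"
proof -
  have "prod_list (map (hook_weight c g) ts) = (\<Prod>i<length ts. hook_weight c g (ts ! i))"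
    by (induction ts) (simp_all add: prod.lessThan_Suc_shift del: prod.lessThan_Suc)
  thus ?thesis
    by (simp add: hook_weight_def prod_vertices_Node num_children_Node_Nil hook_length_Nil
          num_children_Node_Cons hook_length_Node_Cons del: vertices.simps)
qed

section \<open>Recursion for sums over trees of given size\<close>

definition forests :: "nat \<Rightarrow> nat \<Rightarrow> ordered_tree list set" where
  "forests d k = {ts. length ts = d \<and> (\<Sum>t\<leftarrow>ts. card (vertices t)) = k}"

lemma trees_of_size_0: "trees_of_size 0 = {}"
  using card_vertices_pos by (auto simp: trees_of_size_def)

text \<open>Every tree has a vertex, so k vertices below the root allow at most k children; this
  bounds d.\<close>

lemma trees_of_size_Suc: "trees_of_size (Suc k) = Node ` (\<Union>d\<le>k. forests d k)"
proof -
  have "length ts \<le> (\<Sum>t\<leftarrow>ts. card (vertices t))" for ts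
  proof (induction ts)
    case (Cons t ts)
    thus ?case using card_vertices_pos[of t] by simp
  qed simp
  moreover have "T \<in> trees_of_size (Suc k) \<longleftrightarrow> (\<Sum>t\<leftarrow>children T. card (vertices t)) = k" for T
    by (cases T) (simp add: trees_of_size_def card_vertices_Node del: vertices.simps)
  ultimately have "T \<in> trees_of_size (Suc k) \<longleftrightarrow> children T \<in> (\<Union>d\<le>k. forests d k)" for T
    by (auto simp: forests_def)
  moreover have "T \<in> Node ` X \<longleftrightarrow> children T \<in> X" for T X
    by (cases T) auto
  ultimately show ?thesis
    by blast
qed

lemma finite_forests: "finite (forests d k)"
proof (rule finite_imageD)
  have "Node ` forests d k \<subseteq> trees_of_size (Suc k)"
    by (auto simp: trees_of_size_def forests_def card_vertices_Node simp del: vertices.simps)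
  thus "finite (Node ` forests d k)"
    using finite_trees_of_size finite_subset by blast
qed (simp add: inj_on_def)

text \<open>Splitting off the first tree and grading by its size i prepares a Cauchy
  product.\<close>

lemma forests_Suc:
  "forests (Suc d) k
    = (\<lambda>(i, t, ts). t # ts) ` (SIGMA i:{..k}. trees_of_size i \<times> forests d (k - i))"
  by (force simp: forests_def trees_of_size_def length_Suc_conv image_iff)

text \<open>The root has hook length k + 1 in all these trees, so its factor comes out of the
  sum.\<close>

lemma sum_hook_weight_Suc:
  "(\<Sum>T\<in>trees_of_size (Suc k). hook_weight c g T)
    = g (Suc k) * (\<Sum>d\<le>k. c d * (\<Sum>ts\<in>forests d k. prod_list (map (hook_weight c g) ts)))"
proof -
  have "(\<Sum>T\<in>trees_of_size (Suc k). hook_weight c g T)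
      = (\<Sum>ts\<in>(\<Union>d\<le>k. forests d k). hook_weight c g (Node ts))"
    unfolding trees_of_size_Suc by (simp add: sum.reindex inj_on_def)
  also have "\<dots> = (\<Sum>d\<le>k. \<Sum>ts\<in>forests d k. hook_weight c g (Node ts))"
    by (rule sum.UNION_disjoint) (auto simp: finite_forests, auto simp: forests_def)
  also have "\<dots> = (\<Sum>d\<le>k. \<Sum>ts\<in>forests d k.
      c d * g (Suc k) * prod_list (map (hook_weight c g) ts))"
    by (intro sum.cong refl)
      (simp add: hook_weight_Node card_vertices_Node forests_def del: vertices.simps)
  finally show ?thesis
    by (simp add: sum_distrib_left mult_ac)
qed

lemma sum_forests_Suc:
  fixes f :: "ordered_tree \<Rightarrow> 'a::comm_semiring_1"
  shows "(\<Sum>ts\<in>forests (Suc d) k. prod_list (map f ts))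
    = (\<Sum>i\<le>k. (\<Sum>t\<in>trees_of_size i. f t) * (\<Sum>ts\<in>forests d (k - i). prod_list (map f ts)))"
proof -
  \<comment> \<open>The index i is recovered from the list as the number of vertices of its
    head.\<close>
  have inj: "inj_on (\<lambda>(i, t, ts). t # ts) (SIGMA i:{..k}. trees_of_size i \<times> forests d (k - i))"
    by (auto simp: inj_on_def trees_of_size_def)
  have "(\<Sum>ts\<in>forests (Suc d) k. prod_list (map f ts))
      = (\<Sum>(i, t, ts)\<in>(SIGMA i:{..k}. trees_of_size i \<times> forests d (k - i)). f t * prod_list (map f ts))"
    unfolding forests_Suc sum.reindex[OF inj] by (simp add: case_prod_unfold)
  also have "\<dots> = (\<Sum>i\<le>k. \<Sum>(t, ts)\<in>trees_of_size i \<times> forests d (k - i). f t * prod_list (map f ts))"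
    by (subst sum.Sigma) (auto simp: finite_forests finite_trees_of_size)
  finally show ?thesis
    by (simp add: sum_product sum.cartesian_product)
qed

section \<open>Tree sums as coefficients, up to a ring homomorphism\<close>

text \<open>Used for the identity on the reals, for evaluating polynomials at a real z, and for the
  embedding of polynomials into rational functions.\<close>

locale comm_ring_1_hom =
  fixes h :: "'a::comm_ring_1 \<Rightarrow> 'b::comm_ring_1"
  assumes hom_add: "h (x + y) = h x + h y"
    and hom_mult: "h (x * y) = h x * h y"
    and hom_one: "h 1 = 1"
begin

lemma hom_zero: "h 0 = 0"
  using hom_add[of 0 0] by simp

lemma hom_sum: "h (sum f A) = (\<Sum>x\<in>A. h (f x))"
  by (induction A rule: infinite_finite_induct) (simp_all add: hom_zero hom_add)

lemma hom_fps_mult_nth: "h ((F * G) $ k) = (\<Sum>i\<le>k. h (F $ i) * h (G $ (k - i)))"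
  by (simp add: fps_mult_nth hom_sum hom_mult atLeast0AtMost)

lemma hom_fps_power_nth: "h ((F ^ d) $ k) = (Abs_fps (\<lambda>i. h (F $ i)) ^ d) $ k"
proof (induction d arbitrary: k)
  case 0
  show ?case by (simp add: hom_zero hom_one)
next
  case (Suc d)
  show ?case
    by (simp add: hom_fps_mult_nth Suc.IH) (simp add: fps_mult_nth atLeast0AtMost)
qed

text \<open>The assumption reaches only up to size k, so an induction on the size of the tree can
  supply it.\<close>

lemma sum_forests_eq_power_nth:
  assumes "\<And>j. j \<le> k \<Longrightarrow> (\<Sum>t\<in>trees_of_size j. f t) = h (A $ j)"
  shows "(\<Sum>ts\<in>forests d k. prod_list (map f ts)) = h ((A ^ d) $ k)"
  using assms
proof (induction d arbitrary: k)
  case 0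
  have "forests 0 k = (if k = 0 then {[]} else {})"
    by (auto simp: forests_def)
  thus ?case by (simp add: hom_zero hom_one)
next
  case (Suc d)
  thus ?case
    by (simp add: sum_forests_Suc hom_fps_mult_nth)
qed

text \<open>\<open>(A ^ d) $ k\<close> involves only coefficients of index at most k, so the
  recursion determines A, and the tree sums obey it. The values of g lie in the target ring, so they
  may have denominators even when A has polynomial coefficients.\<close>

lemma sum_hook_weight_eqI:
  assumes "A $ 0 = 0"
    and "\<And>k. h (A $ Suc k) = g (Suc k) * h (\<Sum>d\<le>k. c d * (A ^ d) $ k)"
  shows "(\<Sum>T\<in>trees_of_size n. hook_weight (\<lambda>d. h (c d)) g T) = h (A $ n)"
proof (induction n rule: less_induct)
  case (less n)
  show ?case
  proof (cases n)
    case 0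
    thus ?thesis using assms(1) by (simp add: trees_of_size_0 hom_zero)
  next
    case (Suc k)
    hence "(\<Sum>ts\<in>forests d k. prod_list (map (hook_weight (\<lambda>d. h (c d)) g) ts)) = h ((A ^ d) $ k)"
      for d
      using less by (intro sum_forests_eq_power_nth) simp
    thus ?thesis
      unfolding Suc sum_hook_weight_Suc assms(2) by (simp add: hom_sum hom_mult)
  qed
qed

end

section \<open>Coefficients for the binomial family\<close>

lemma sum_gchoose_power_nth:
  fixes A :: "real fps"
  shows "(\<Sum>d\<le>k. (m gchoose d) * s ^ d * (A ^ d) $ k) = (fps_binomial m oo (fps_const s * A)) $ k"
  by (simp add: fps_compose_nth atLeast0AtMost power_mult_distrib fps_const_power mult.assoc)

text \<open>Here 1 + s A is \<open>abel_fps z\<close> at s m x, so its m-th power is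
  \<open>abel_fps (m * z)\<close> at s m x.\<close>

lemma sum_gchoose_abel_nth:
  fixes s m z :: real
  defines "A \<equiv> Abs_fps (\<lambda>n. if n = 0 then 0 else s ^ (n - 1) * m ^ n / fact n * (z * (z + of_nat n) ^ (n - 1)))"
  shows "(\<Sum>d\<le>k. (m gchoose d) * s ^ d * (A ^ d) $ k) = (s * m) ^ k * abel_fps (m * z) $ k"
proof -
  define L where "L = fps_const (s * m) * fps_X"
  have "(fps_const s * A) $ n = ((abel_fps z - 1) oo L) $ n" for n
    unfolding L_def fps_nth_compose_linear
    by (cases n) (simp_all add: A_def abel_fps_def power_mult_distrib mult_ac)
  hence "fps_const s * A = (abel_fps z - 1) oo L"
    by (simp add: fps_eq_iff)
  moreover have "fps_binomial m oo ((abel_fps z - 1) oo L) = fps_binomial m oo (abel_fps z - 1) oo L"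
    by (rule fps_compose_assoc) (simp_all add: L_def abel_fps_def)
  ultimately show ?thesis
    by (simp add: sum_gchoose_power_nth fps_binomial_compose_abel L_def)
qed

lemma sum_hook_weight_real:
  fixes s m :: real
  assumes "m \<noteq> 0" "n \<ge> 1"
  shows "(\<Sum>T\<in>trees_of_size n.
      hook_weight (\<lambda>d. (m gchoose d) * s ^ d) (\<lambda>h. 1 / (of_nat h * m ^ (h - 1))) T)
    = s ^ (n - 1) / fact n"
proof -
  define A where "A = Abs_fps (\<lambda>n. if n = 0 then 0 else s ^ (n - 1) / fact n)"
  interpret comm_ring_1_hom "\<lambda>x::real. x"
    by unfold_locales simp_all
  have "(fps_const s * A) $ n = (fps_exp s - 1) $ n" for n
    by (cases n) (simp_all add: A_def del: fact_Suc)
  hence "fps_const s * A = fps_exp s - 1"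
    by (simp add: fps_eq_iff)
  hence "(\<Sum>d\<le>k. (m gchoose d) * s ^ d * (A ^ d) $ k) = (m * s) ^ k / fact k" for k
    by (simp add: sum_gchoose_power_nth fps_binomial_compose_exp)
  \<comment> \<open>The hook factor 1 / ((k+1) m^k) turns (m s)^k / k! into s^k / (k+1)!.\<close>
  hence "A $ Suc k = 1 / (of_nat (Suc k) * m ^ (Suc k - 1)) *
      (\<Sum>d\<le>k. (m gchoose d) * s ^ d * (A ^ d) $ k)" for k
    using assms by (simp add: A_def power_mult_distrib)
  hence "(\<Sum>T\<in>trees_of_size n.
      hook_weight (\<lambda>d. (m gchoose d) * s ^ d) (\<lambda>h. 1 / (of_nat h * m ^ (h - 1))) T) = A $ n"
    by (intro sum_hook_weight_eqI) (simp_all add: A_def)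
  thus ?thesis using assms by (simp add: A_def)
qed

text \<open>Two real polynomials agreeing at every real z are equal. \<open>[:0, 1:]\<close> is z
  and \<open>[:of_nat n, 1:]\<close> is z + n.\<close>

lemma sum_gchoose_abel_poly_nth:
  fixes s m :: real
  defines "P \<equiv> Abs_fps (\<lambda>n. if n = 0 then 0 else
      smult (s ^ (n - 1) * m ^ n / fact n) ([:0, 1:] * [:of_nat n, 1:] ^ (n - 1)))"
  shows "(\<Sum>d\<le>k. [:(m gchoose d) * s ^ d:] * (P ^ d) $ k)
    = (if k = 0 then 1 else smult ((s * m) ^ k / fact k) ([:0, m:] * [:of_nat k, m:] ^ (k - 1)))"
    (is "?L = ?R")
proof -
  have "poly ?L z = poly ?R z" for z
  proof -
    interpret comm_ring_1_hom "\<lambda>p. poly p z"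
      by unfold_locales simp_all
    have P: "Abs_fps (\<lambda>i. poly (P $ i) z)
        = Abs_fps (\<lambda>n. if n = 0 then 0 else s ^ (n - 1) * m ^ n / fact n * (z * (z + of_nat n) ^ (n - 1)))"
      by (simp add: P_def fps_eq_iff add_ac)
    have "poly ?L z = (\<Sum>d\<le>k. (m gchoose d) * s ^ d * poly ((P ^ d) $ k) z)"
      by (simp add: poly_sum)
    also have "\<dots> = (s * m) ^ k * abel_fps (m * z) $ k"
      unfolding hom_fps_power_nth P by (rule sum_gchoose_abel_nth)
    also have "\<dots> = poly ?R z"
      by (simp add: abel_fps_def mult_ac add_ac)
    finally show ?thesis .
  qed
  thus ?thesis by (simp add: poly_eq_poly_eq_iff [symmetric] fun_eq_iff)
qed

section \<open>The second identity in the field of rational functions\<close>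

lemma to_fract_power: "to_fract (p ^ n) = to_fract p ^ n"
  by (induction n) simp_all

lemma rf_const_1: "rf_const 1 = 1"
  by (simp add: rf_const_def flip: one_pCons)

lemma rf_const_mult: "rf_const (a * b) = rf_const a * rf_const b"
  by (simp add: rf_const_def flip: to_fract_mult)

lemma rf_const_power: "rf_const (a ^ n) = rf_const a ^ n"
  by (induction n) (simp_all add: rf_const_1 rf_const_mult)

lemma rf_const_prod: "rf_const (prod f A) = (\<Prod>x\<in>A. rf_const (f x))"
  by (induction A rule: infinite_finite_induct) (simp_all add: rf_const_1 rf_const_mult)

lemma rf_const_of_nat: "rf_const (of_nat n) = of_nat n"
proof (induction n)
  case (Suc n)
  have "rf_const (of_nat (Suc n)) = 1 + rf_const (of_nat n)"
    by (simp add: rf_const_def one_pCons flip: to_fract_1 to_fract_add)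
  thus ?case by (simp add: Suc)
qed (simp add: rf_const_def)

lemma rf_const_divide:
  assumes "b \<noteq> 0"
  shows "rf_const (a / b) = rf_const a / rf_const b"
proof -
  have "rf_const b \<noteq> 0" using assms by (simp add: rf_const_def)
  thus ?thesis
    using assms by (simp add: eq_divide_eq flip: rf_const_mult)
qed

lemma rf_const_divide_fact: "rf_const (a / fact n) = rf_const a / fact n"
  using rf_const_of_nat[of "fact n"] by (simp add: rf_const_divide)

lemma to_fract_smult: "to_fract (smult c p) = rf_const c * to_fract p"
  by (simp add: rf_const_def flip: to_fract_mult)

lemma to_fract_linear: "to_fract [:of_nat n, c:] = rf_const c * rf_var + of_nat n"
proof -
  have "[:of_nat n, c:] = [:c:] * [:0, 1:] + [:of_nat n:]" by simp
  thus ?thesis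
    by (simp only: to_fract_add to_fract_mult rf_var_def flip: rf_const_def rf_const_of_nat)
qed

lemma sum_hook_weight_fract:
  fixes s m :: real
  assumes "m \<noteq> 0" "n \<ge> 1"
  shows "(\<Sum>T\<in>trees_of_size n.
      hook_weight (\<lambda>d. rf_const ((m gchoose d) * s ^ d))
        (\<lambda>h. (rf_var + of_nat h) ^ (h - 1) /
          (of_nat h * (rf_const m * rf_var + of_nat h - 1) powi (int h - 2))) T)
    = rf_const (s ^ (n - 1) * m ^ n) * rf_var / fact n * (rf_var + of_nat n) ^ (n - 1)"
proof -
  define P where "P = Abs_fps (\<lambda>n. if n = 0 then 0 else
      smult (s ^ (n - 1) * m ^ n / fact n) ([:0, 1:] * [:of_nat n, 1:] ^ (n - 1)))"
  define g where "g = (\<lambda>h. (rf_var + of_nat h) ^ (h - 1) /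
      (of_nat h * (rf_const m * rf_var + of_nat h - 1) powi (int h - 2)))"
  interpret comm_ring_1_hom "to_fract :: real poly \<Rightarrow> _"
    by unfold_locales simp_all
  have P: "to_fract (P $ n)
      = rf_const (s ^ (n - 1) * m ^ n) * rf_var / fact n * (rf_var + of_nat n) ^ (n - 1)"
    if "n > 0" for n
    using that to_fract_linear[of n 1]
    by (simp add: P_def to_fract_smult to_fract_power rf_const_1 rf_const_divide_fact mult.assoc
          rf_var_def del: smult_pCons mult_pCons_left)
  have "to_fract (P $ Suc k)
      = g (Suc k) * to_fract (\<Sum>d\<le>k. [:(m gchoose d) * s ^ d:] * (P ^ d) $ k)" for k
  proof -
    \<comment> \<open>The denominator base m z + h - 1 at h = k + 1; it is nonzero because m
      is.\<close>
    define Y where "Y = rf_const m * rf_var + of_nat k"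
    have "Y = to_fract [:of_nat k, m:]"
      by (simp only: Y_def to_fract_linear)
    hence Y: "Y \<noteq> 0" using assms by simp
    have g: "g (Suc k) = (rf_var + of_nat (Suc k)) ^ k / (of_nat (Suc k) * Y powi (int k - 1))"
      by (simp add: g_def Y_def)
    have S: "(\<Sum>d\<le>k. [:(m gchoose d) * s ^ d:] * (P ^ d) $ k)
      = (if k = 0 then 1 else smult ((s * m) ^ k / fact k) ([:0, m:] * [:of_nat k, m:] ^ (k - 1)))"
      unfolding P_def by (rule sum_gchoose_abel_poly_nth)
    show ?thesis
    proof (cases "k = 0")
      case True
      \<comment> \<open>Hook length 1: the exponent is -1, so the denominator contributes the factor
        Y = m z, and the inner sum is 1.\<close>
      thus ?thesis
        unfolding S g using Y by (simp add: P power_int_minus) (simp add: Y_def field_simps)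
    next
      case False
      have 0: "to_fract [:0, m:] = rf_const m * rf_var"
        using to_fract_linear[of 0 m] by simp
      \<comment> \<open>For k > 0 the exponent is a natural number, and this power cancels the one
        in the Abel coefficient.\<close>
      have pow: "Y powi (int k - 1) = Y ^ (k - 1)"
        using False by (simp flip: power_int_of_nat add: of_nat_diff)
      have "to_fract (\<Sum>d\<le>k. [:(m gchoose d) * s ^ d:] * (P ^ d) $ k)
          = rf_const ((s * m) ^ k) / fact k * (rf_const m * rf_var * Y ^ (k - 1))"
        unfolding S using False
        by (simp only: to_fract_smult to_fract_mult to_fract_power rf_const_divide_fact
              to_fract_linear 0 Y_def if_False)
      thus ?thesis
        using Y by (simp add: P g pow rf_const_mult rf_const_power power_mult_distrib field_simps
          del: of_nat_Suc)
    qed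
  qed
  hence "(\<Sum>T\<in>trees_of_size n. hook_weight (\<lambda>d. to_fract [:(m gchoose d) * s ^ d:]) g T) = to_fract (P $ n)"
    by (intro sum_hook_weight_eqI) (simp_all add: P_def)
  thus ?thesis
    using P[of n] assms by (simp add: g_def rf_const_def)
qed

theorem theorem1:
  fixes s m :: real and n :: nat
  assumes "s * m > 0"
    and "s > 0 \<longrightarrow> (\<exists>k::nat. k > 0 \<and> m = of_nat k)"
    and "n \<ge> 1"
  shows "(\<Sum>T\<in>trees_of_size n. binomial_weight s m T *
            (\<Prod>v\<in>vertices T. 1 / (of_nat (hook_length T v) * m ^ (hook_length T v - 1))))
         = s ^ (n - 1) / fact n \<and>
         (\<Sum>T\<in>trees_of_size n. rf_const (binomial_weight s m T) *
            (\<Prod>v\<in>vertices T.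
               (rf_var + of_nat (hook_length T v)) ^ (hook_length T v - 1) /
               (of_nat (hook_length T v) *
                (rf_const m * rf_var + of_nat (hook_length T v) - 1)
                  powi (int (hook_length T v) - 2))))
         = rf_const (s ^ (n - 1) * m ^ n) * rf_var / fact n * (rf_var + of_nat n) ^ (n - 1)"
proof -
  have m: "m \<noteq> 0" using assms(1) by auto
  \<comment> \<open>Splitting the product of \<open>hook_weight\<close> over the vertices gives the
    binomial weight times the product of hook factors.\<close>
  show ?thesis
    using sum_hook_weight_real[OF m assms(3), of s] sum_hook_weight_fract[OF m assms(3), of s]
    by (simp only: hook_weight_def binomial_weight_def rf_const_prod rf_const_mult prod.distrib simp_thms)
qed

end
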